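(* Let $(\mathfrak{X},\Gamma,\Phi)$ be an odometer, and let $\mathcal{G}$ be a group chain model for it. Then the typeset $\Xi[\mathcal{G}]$ is independent of the choice of the group chain model $\mathcal{G}$. Thus $\Xi[\mathfrak{X},\Gamma,\Phi]:=\Xi[\mathcal{G}]$ is an invariant under isomorphism of the action: isomorphic odometers have equal typesets.
   Context: Odometers. A Cantor action $(\mathfrak{X},\Gamma,\Phi)$ is an action of a group $\Gamma$ by homeomorphisms on a Cantor space $\mathfrak{X}$. It is minimal if every orbit is dense, and equicontinuous if for a (equivalently any) metric $d_{\mathfrak{X}}$ compatible with the topology, for all $\varepsilon>0$ there is $\delta>0$ such that $d_{\mathfrak{X}}(x,y)<\delta$ implies $d_{\mathfrak{X}}(g\cdot x,g\cdot y)<\varepsilon$ for all $g\in\Gamma$. A ($\Gamma$-)odometer is a minimal equicontinuous Cantor action. Actions $(\mathfrak{X}_1,\Gamma_1,\Phi_1)$, $(\mathfrak{X}_2,\Gamma_2,\Phi_2)$ are isomorphic if there are a homeomorphism $h\colon\mathfrak{X}_1\to\mathfrak{X}_2$ and a group isomorphism $\Theta\colon\Gamma_1\to\Gamma_2$ with $\Phi_1(g)=h^{-1}\circ\Phi_2(\Theta(g))\circ h$ for all $g\in\Gamma_1$. Group chain models. A group chain $\mathcal{G}=\{\Gamma=\Gamma_0\supset\Gamma_1\supset\cdots\}$ is a descending chain of finite index subgroups (not assumed normal). Put $X_\ell=\Gamma/\Gamma_\ell$, $X_\infty=\varprojlim\{X_{\ell+1}\to X_\ell\}$, and let $\Phi_\infty$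 be the action of $\Gamma$ on $X_\infty$ induced by left multiplication. $\mathcal{G}$ is a group chain model for $(\mathfrak{X},\Gamma,\Phi)$ if there is a homeomorphism $\mathfrak{X}\to X_\infty$ conjugating $\Phi$ to $\Phi_\infty$ (as $\Gamma$-actions). Every odometer is known to have a group chain model. Types and typesets. A Steinitz number is a formal product $\xi=\prod_{p}p^{\chi_\xi(p)}$ over all primes $p$, with $\chi_\xi(p)\in\{0,1,\ldots,\infty\}$; the least common multiple of a collection of positive integers is a Steinitz number, with exponent at $p$ the supremum of the exponents. $\xi,\xi'$ are asymptotically equivalent if $m\cdot\xi=m'\cdot\xi'$ for some integers $m,m'\ge1$; the equivalence class of $\xi$ is its type $\tau[\xi]$. Given a group chain $\mathcal{G}$, let $C_\ell=\bigcap_{\delta\in\Gamma}\delta\Gamma_\ell\delta^{-1}$ be the normal core of $\Gamma_\ell$ in $\Gamma$. For $\gamma\in\Gamma$ let $\langle\gamma\rangle_\ell=\langle\gamma\rangle\cap C_\ell$, $\xi(\gamma)=\mathrm{lcm}\{\#(\langle\gamma\rangle/\langle\gamma\rangle_\ell)\mid\ell>0\}$, and $\tau[\gamma]=\tau[\xi(\gamma)]$ ($\gamma$ may be the identity). The typeset of $\mathcal{G}$ is $\Xi[\mathcal{G}]=\{\tau[\gamma]\mid\gamma\in\Gamma\}$. *)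

theory Defs
  imports
    "HOL-Analysis.Analysis"
    "HOL-Algebra.Group_Action"
    "HOL-Algebra.Generated_Groups"
    "HOL-Algebra.Left_Coset"
    "HOL-Computational_Algebra.Primes"
    "HOL-Library.Extended_Nat"
begin

section \<open>Odometers\<close>

definition cantor_space :: "'a topology \<Rightarrow> bool" where
  "cantor_space X \<longleftrightarrow>
     X homeomorphic_space
       product_topology (\<lambda>_. discrete_topology (UNIV :: bool set)) (UNIV :: nat set)"

definition cantor_action ::
  "'a topology \<Rightarrow> ('g, 'm) monoid_scheme \<Rightarrow> ('g \<Rightarrow> 'a \<Rightarrow> 'a) \<Rightarrow> bool" where
  "cantor_action X G \<Phi> \<longleftrightarrow>
     cantor_space X \<and> group_action G (topspace X) \<Phi> \<and>
     (\<forall>g\<in>carrier G. homeomorphic_map X X (\<Phi> g))"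

definition minimal_action ::
  "'a topology \<Rightarrow> ('g, 'm) monoid_scheme \<Rightarrow> ('g \<Rightarrow> 'a \<Rightarrow> 'a) \<Rightarrow> bool" where
  "minimal_action X G \<Phi> \<longleftrightarrow>
     (\<forall>x\<in>topspace X. X closure_of (orbit G \<Phi> x) = topspace X)"

definition equicontinuous_action ::
  "'a topology \<Rightarrow> ('g, 'm) monoid_scheme \<Rightarrow> ('g \<Rightarrow> 'a \<Rightarrow> 'a) \<Rightarrow> bool" where
  "equicontinuous_action X G \<Phi> \<longleftrightarrow>
     (\<exists>d. Metric_space (topspace X) d \<and> Metric_space.mtopology (topspace X) d = X \<and>
        (\<forall>\<epsilon>>0. \<exists>\<delta>>0. \<forall>x\<in>topspace X. \<forall>y\<in>topspace X. d x y < \<delta> \<longrightarrow>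
           (\<forall>g\<in>carrier G. d (\<Phi> g x) (\<Phi> g y) < \<epsilon>)))"

definition odometer ::
  "'a topology \<Rightarrow> ('g, 'm) monoid_scheme \<Rightarrow> ('g \<Rightarrow> 'a \<Rightarrow> 'a) \<Rightarrow> bool" where
  "odometer X G \<Phi> \<longleftrightarrow>
     cantor_action X G \<Phi> \<and> minimal_action X G \<Phi> \<and> equicontinuous_action X G \<Phi>"

definition isomorphic_actions ::
  "'a topology \<Rightarrow> ('g, 'm) monoid_scheme \<Rightarrow> ('g \<Rightarrow> 'a \<Rightarrow> 'a) \<Rightarrow>
   'b topology \<Rightarrow> ('h, 'n) monoid_scheme \<Rightarrow> ('h \<Rightarrow> 'b \<Rightarrow> 'b) \<Rightarrow> bool" where
  "isomorphic_actions X\<^sub>1 G\<^sub>1 \<Phi>\<^sub>1 X\<^sub>2 G\<^sub>2 \<Phi>\<^sub>2 \<longleftrightarrow>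
     (\<exists>h h' \<Theta>. homeomorphic_maps X\<^sub>1 X\<^sub>2 h h' \<and> \<Theta> \<in> iso G\<^sub>1 G\<^sub>2 \<and>
        (\<forall>g\<in>carrier G\<^sub>1. \<forall>x\<in>topspace X\<^sub>1. \<Phi>\<^sub>1 g x = h' (\<Phi>\<^sub>2 (\<Theta> g) (h x))))"


section \<open>Group chain models\<close>

text \<open>Chains are descending in the weak sense: consecutive terms may coincide.\<close>

definition group_chain :: "('g, 'm) monoid_scheme \<Rightarrow> (nat \<Rightarrow> 'g set) \<Rightarrow> bool" where
  "group_chain G \<G> \<longleftrightarrow>
     \<G> 0 = carrier G \<and>
     (\<forall>l. subgroup (\<G> l) G \<and> \<G> (Suc l) \<subseteq> \<G> l \<and> finite (lcosets\<^bsub>G\<^esub> (\<G> l)))"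

text \<open>The bonding map sends the coset of \<open>g\<close> modulo \<open>\<G> (Suc l)\<close> to the coset of \<open>g\<close>
  modulo \<open>\<G> l\<close>; the inverse limit is the set of sequences compatible with it.\<close>

definition chain_limit_set :: "('g, 'm) monoid_scheme \<Rightarrow> (nat \<Rightarrow> 'g set) \<Rightarrow> (nat \<Rightarrow> 'g set) set" where
  "chain_limit_set G \<G> =
     {s. \<forall>l. \<exists>g\<in>carrier G. s (Suc l) = g <#\<^bsub>G\<^esub> \<G> (Suc l) \<and> s l = g <#\<^bsub>G\<^esub> \<G> l}"

definition chain_limit :: "('g, 'm) monoid_scheme \<Rightarrow> (nat \<Rightarrow> 'g set) \<Rightarrow> (nat \<Rightarrow> 'g set) topology" where
  "chain_limit G \<G> =
     subtopology (product_topology (\<lambda>l. discrete_topology (lcosets\<^bsub>G\<^esub> (\<G> l))) UNIV)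
       (chain_limit_set G \<G>)"

definition chain_action ::
  "('g, 'm) monoid_scheme \<Rightarrow> 'g \<Rightarrow> (nat \<Rightarrow> 'g set) \<Rightarrow> (nat \<Rightarrow> 'g set)" where
  "chain_action G g s = (\<lambda>l. g <#\<^bsub>G\<^esub> s l)"

definition group_chain_model ::
  "'a topology \<Rightarrow> ('g, 'm) monoid_scheme \<Rightarrow> ('g \<Rightarrow> 'a \<Rightarrow> 'a) \<Rightarrow> (nat \<Rightarrow> 'g set) \<Rightarrow> bool" where
  "group_chain_model X G \<Phi> \<G> \<longleftrightarrow>
     group_chain G \<G> \<and>
     (\<exists>h. homeomorphic_map X (chain_limit G \<G>) h \<and>
        (\<forall>g\<in>carrier G. \<forall>x\<in>topspace X. h (\<Phi> g x) = chain_action G g (h x)))"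


section \<open>Steinitz numbers and types\<close>

text \<open>A Steinitz number is represented by its exponent function, set to \<open>0\<close> at all
  non-primes so that equality of Steinitz numbers is equality of functions.\<close>

definition steinitz_numbers :: "(nat \<Rightarrow> enat) set" where
  "steinitz_numbers = {\<xi>. \<forall>p. \<not> prime p \<longrightarrow> \<xi> p = 0}"

definition steinitz_of_nat :: "nat \<Rightarrow> nat \<Rightarrow> enat" where
  "steinitz_of_nat n p = (if prime p then enat (multiplicity p n) else 0)"

definition steinitz_mult :: "(nat \<Rightarrow> enat) \<Rightarrow> (nat \<Rightarrow> enat) \<Rightarrow> (nat \<Rightarrow> enat)" where
  "steinitz_mult \<xi> \<xi>' = (\<lambda>p. \<xi> p + \<xi>' p)"

definition steinitz_lcm :: "nat set \<Rightarrow> nat \<Rightarrow> enat" where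
  "steinitz_lcm A p = (SUP n\<in>A. steinitz_of_nat n p)"

definition asymptotically_equivalent :: "(nat \<Rightarrow> enat) \<Rightarrow> (nat \<Rightarrow> enat) \<Rightarrow> bool" where
  "asymptotically_equivalent \<xi> \<xi>' \<longleftrightarrow>
     (\<exists>m m'. m \<ge> 1 \<and> m' \<ge> 1 \<and>
        steinitz_mult (steinitz_of_nat m) \<xi> = steinitz_mult (steinitz_of_nat m') \<xi>')"

definition steinitz_type :: "(nat \<Rightarrow> enat) \<Rightarrow> (nat \<Rightarrow> enat) set" where
  "steinitz_type \<xi> = {\<xi>' \<in> steinitz_numbers. asymptotically_equivalent \<xi> \<xi>'}"


section \<open>Typesets\<close>

definition normal_core :: "('g, 'm) monoid_scheme \<Rightarrow> 'g set \<Rightarrow> 'g set" where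
  "normal_core G H = (\<Inter>\<delta>\<in>carrier G. (\<delta> <#\<^bsub>G\<^esub> H) #>\<^bsub>G\<^esub> inv\<^bsub>G\<^esub> \<delta>)"

definition element_order_mod_core ::
  "('g, 'm) monoid_scheme \<Rightarrow> (nat \<Rightarrow> 'g set) \<Rightarrow> 'g \<Rightarrow> nat \<Rightarrow> nat" where
  "element_order_mod_core G \<G> \<gamma> l =
     order (G\<lparr>carrier := generate G {\<gamma>}\<rparr> Mod (generate G {\<gamma>} \<inter> normal_core G (\<G> l)))"

definition steinitz_order ::
  "('g, 'm) monoid_scheme \<Rightarrow> (nat \<Rightarrow> 'g set) \<Rightarrow> 'g \<Rightarrow> nat \<Rightarrow> enat" where
  "steinitz_order G \<G> \<gamma> = steinitz_lcm {element_order_mod_core G \<G> \<gamma> l | l. l > 0}"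

definition typeset ::
  "('g, 'm) monoid_scheme \<Rightarrow> (nat \<Rightarrow> 'g set) \<Rightarrow> (nat \<Rightarrow> enat) set set" where
  "typeset G \<G> = {steinitz_type (steinitz_order G \<G> \<gamma>) | \<gamma>. \<gamma> \<in> carrier G}"

text \<open>The common value of the typesets of all group chain models; an odometer always has
  a model, so the description denotes as soon as this value does not depend on the model.\<close>

definition odometer_typeset ::
  "'a topology \<Rightarrow> ('g, 'm) monoid_scheme \<Rightarrow> ('g \<Rightarrow> 'a \<Rightarrow> 'a) \<Rightarrow> (nat \<Rightarrow> enat) set set" where
  "odometer_typeset X G \<Phi> = (THE T. \<exists>\<G>. group_chain_model X G \<Phi> \<G> \<and> T = typeset G \<G>)"

end

theory Submission
  imports Defs "HOL-Algebra.Multiplicative_Group"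
begin

text \<open>The order of \<open>\<gamma>\<close> modulo the core \<open>C\<^sub>l\<close> is characterised by: it divides \<open>k\<close> iff
  \<open>\<gamma>\<^sup>k \<in> C\<^sub>l\<close>. Hence \<open>\<xi>(\<gamma>)\<close> depends only on the family of cores up to mutual cofinality. Two
  models of one action have equivariantly homeomorphic limits, and continuity of the homeomorphism
  at the base point makes the cores mutually cofinal, so even the Steinitz orders agree, not just
  their types. An isomorphism of actions carries a model of the first action to a model of the
  second with the same typeset; as this works in both directions, the invariant can be compared
  without knowing that a model exists.\<close>

section \<open>Orders of elements modulo normal cores\<close>

lemma (in group) inv_cancel_left:
  assumes "x \<in> carrier G" "y \<in> carrier G"
  shows "inv x \<otimes> (x \<otimes> y) = y" "x \<otimes> (inv x \<otimes> y) = y"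
  using assms by (simp_all flip: m_assoc)

text \<open>Moving the conjugation from the subgroup to the element turns the intersection of set
  products into a pointwise condition, the only form of the core used in later computations.\<close>

lemma (in group) mem_normal_core_iff:
  assumes "subgroup K G"
  shows "x \<in> normal_core G K \<longleftrightarrow> x \<in> carrier G \<and> (\<forall>d\<in>carrier G. inv d \<otimes> x \<otimes> d \<in> K)"
    (is "?L \<longleftrightarrow> ?R")
proof
  interpret K: subgroup K G by fact
  have conj: "x \<in> (d <# K) #> inv d \<longleftrightarrow> (\<exists>k\<in>K. x = d \<otimes> k \<otimes> inv d)" for d
    by (auto simp: l_coset_def r_coset_def)
  have cancel: "inv d \<otimes> (d \<otimes> k \<otimes> inv d) \<otimes> d = k" if "d \<in> carrier G" "k \<in> carrier G" for d k
    using that by (simp add: m_assoc inv_cancel_left)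
  have cancel': "d \<otimes> (inv d \<otimes> y \<otimes> d) \<otimes> inv d = y" if "d \<in> carrier G" "y \<in> carrier G" for d y
    using cancel[of "inv d" y] that by simp
  show ?R if ?L
  proof
    have all: "\<exists>k\<in>K. x = d \<otimes> k \<otimes> inv d" if "d \<in> carrier G" for d
      using \<open>?L\<close> that conj by (auto simp: normal_core_def)
    \<comment> \<open>The intersection has a nonempty index set: its term at \<open>\<one>\<close>
      already puts \<open>x\<close> in the carrier.\<close>
    then show "x \<in> carrier G"
      using all[of \<one>] K.mem_carrier by auto
    show "\<forall>d\<in>carrier G. inv d \<otimes> x \<otimes> d \<in> K"
      using all cancel K.mem_carrier by fastforce
  qed
  show ?L if ?R
    unfolding normal_core_def
  proof
    fix d assume "d \<in> carrier G"
    then show "x \<in> (d <# K) #> inv d"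
      unfolding conj using that cancel'[of d x] by (intro bexI[of _ "inv d \<otimes> x \<otimes> d"]) auto
  qed
qed

lemma (in group) normal_core_normal:
  assumes "subgroup K G"
  shows "normal_core G K \<lhd> G"
proof (rule normal_invI)
  interpret K: subgroup K G by fact
  note core = mem_normal_core_iff[OF assms]
  have conj_mult: "inv d \<otimes> (x \<otimes> y) \<otimes> d = (inv d \<otimes> x \<otimes> d) \<otimes> (inv d \<otimes> y \<otimes> d)"
    if "d \<in> carrier G" "x \<in> carrier G" "y \<in> carrier G" for d x y
    using that by (simp add: m_assoc inv_cancel_left)
  have conj_inv: "inv d \<otimes> inv x \<otimes> d = inv (inv d \<otimes> x \<otimes> d)"
    if "d \<in> carrier G" "x \<in> carrier G" for d x
    using that by (simp add: inv_mult_group m_assoc)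
  show "subgroup (normal_core G K) G"
  proof (rule subgroupI)
    show "normal_core G K \<noteq> {}"
      using core[of \<one>] by force
    show "normal_core G K \<subseteq> carrier G"
      using core by blast
    show "inv x \<in> normal_core G K" if "x \<in> normal_core G K" for x
      using that conj_inv unfolding core by (metis K.m_inv_closed inv_closed)
    show "x \<otimes> y \<in> normal_core G K" if "x \<in> normal_core G K" "y \<in> normal_core G K" for x y
      using that conj_mult unfolding core by (metis K.m_closed m_closed)
  qed
  show "x \<otimes> h \<otimes> inv x \<in> normal_core G K"
    if "x \<in> carrier G" "h \<in> normal_core G K" for x h
  proof -
    have h: "h \<in> carrier G" "\<And>d. d \<in> carrier G \<Longrightarrow> inv d \<otimes> h \<otimes> d \<in> K"
      using that core by auto
    \<comment> \<open>Conjugating \<open>h\<close> by \<open>x\<close> only reindexes the condition: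
      the conjugator \<open>d\<close> becomes \<open>inv x \<otimes> d\<close>.\<close>
    have "inv d \<otimes> (x \<otimes> h \<otimes> inv x) \<otimes> d = inv (inv x \<otimes> d) \<otimes> h \<otimes> (inv x \<otimes> d)"
      if "d \<in> carrier G" for d
      using that h(1) \<open>x \<in> carrier G\<close> by (simp add: inv_mult_group m_assoc)
    moreover have "inv (inv x \<otimes> d) \<otimes> h \<otimes> (inv x \<otimes> d) \<in> K" if "d \<in> carrier G" for d
      using h(2) that \<open>x \<in> carrier G\<close> by simp
    ultimately show ?thesis
      using h(1) \<open>x \<in> carrier G\<close> unfolding core by (metis inv_closed m_closed)
  qed
qed

text \<open>The coset of \<open>a\<close> generates the quotient, so the order of the quotient is
  the order of that coset. An infinite quotient is covered as well: its \<open>order\<close> is 0,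
  and 0 divides only 0.\<close>

lemma (in group) order_cyclic_Mod_dvd_iff:
  fixes k :: nat
  assumes a: "a \<in> carrier G" and N: "N \<lhd> G\<lparr>carrier := generate G {a}\<rparr>"
  shows "order (G\<lparr>carrier := generate G {a}\<rparr> Mod N) dvd k \<longleftrightarrow> a [^] k \<in> N"
proof -
  define A where "A = G\<lparr>carrier := generate G {a}\<rparr>"
  have sub: "subgroup (generate G {a}) G"
    using a by (simp add: generate_is_subgroup)
  interpret N: normal N A
    using N by (simp add: A_def)
  interpret Q: group "A Mod N"
    by (rule N.factorgroup_is_group)
  interpret q: group_hom A "A Mod N" "\<lambda>x. N #>\<^bsub>A\<^esub> x"
    by (simp add: N.r_coset_hom_Mod N.is_group Q.is_group group_hom.intro group_hom_axioms.intro)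
  have aA: "a \<in> carrier A"
    by (simp add: A_def generate.incl)
  have "generate A {a} = carrier A"
    using generate_consistent[OF _ sub, of "{a}"] by (simp add: A_def generate.incl)
  then have "generate (A Mod N) {N #>\<^bsub>A\<^esub> a} = (\<lambda>x. N #>\<^bsub>A\<^esub> x) ` carrier A"
    using q.generate_img[of "{a}"] aA by simp
  also have "\<dots> = carrier (A Mod N)"
    by (auto simp: FactGroup_def RCOSETS_def)
  finally have "order (A Mod N) = Q.ord (N #>\<^bsub>A\<^esub> a)"
    using Q.generate_pow_card[of "N #>\<^bsub>A\<^esub> a"] aA by (simp add: order_def)
  then have "order (A Mod N) dvd k \<longleftrightarrow> (N #>\<^bsub>A\<^esub> a) [^]\<^bsub>A Mod N\<^esub> k = \<one>\<^bsub>A Mod N\<^esub>"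
    using Q.pow_eq_id[of "N #>\<^bsub>A\<^esub> a" k] aA by simp
  also have "\<dots> \<longleftrightarrow> N #>\<^bsub>A\<^esub> (a [^]\<^bsub>A\<^esub> k) = N"
    using q.hom_nat_pow[OF aA, of k] by (simp add: FactGroup_def)
  also have "\<dots> \<longleftrightarrow> a [^]\<^bsub>A\<^esub> k \<in> N"
    using N.coset_join1 N.coset_join2 N.subgroup_axioms aA by (meson N.nat_pow_closed)
  finally show ?thesis
    by (simp add: A_def nat_pow_consistent[symmetric])
qed

lemma (in group) element_order_mod_core_dvd_iff:
  assumes "subgroup (\<G> l) G" "a \<in> carrier G"
  shows "element_order_mod_core G \<G> a l dvd k \<longleftrightarrow> a [^] k \<in> normal_core G (\<G> l)"
proof -
  have sub: "subgroup (generate G {a}) G"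
    using assms by (simp add: generate_is_subgroup)
  have "normal_core G (\<G> l) \<inter> generate G {a} \<lhd> G\<lparr>carrier := generate G {a}\<rparr>"
    by (intro normal_Int_subgroup sub normal_core_normal assms)
  \<comment> \<open>Powers of \<open>a\<close> lie in the cyclic subgroup, so membership in the
    intersection reduces to membership in the core.\<close>
  moreover have "a [^] k \<in> generate G {a}"
    using subgroup_int_pow_closed[OF sub generate.incl, of a "int k"] by (simp add: int_pow_int)
  ultimately show ?thesis
    unfolding element_order_mod_core_def
    by (subst order_cyclic_Mod_dvd_iff) (auto simp: assms Int_commute)
qed

text \<open>The powers of \<open>a\<close> act on the finitely many left cosets of \<open>K\<close>.
  By pigeonhole two exponents \<open>i < j\<close> act alike; evaluating at \<open>d <# K\<close>
  puts the conjugate of \<open>a [^] (j - i)\<close> by each \<open>d\<close> into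
  \<open>K\<close>.\<close>

lemma (in group) finite_index_pow_mem_normal_core:
  assumes K: "subgroup K G" "finite (lcosets K)" and a: "a \<in> carrier G"
  obtains k :: nat where "k > 0" "a [^] k \<in> normal_core G K"
proof -
  interpret K: subgroup K G by fact
  \<comment> \<open>The restriction makes \<open>f n\<close> extensional, hence an element of the
    finite function space on \<open>lcosets K\<close>.\<close>
  define f where "f n = (\<lambda>c\<in>lcosets K. (a [^] n) <# c)" for n :: nat
  have closed: "(a [^] n) <# c \<in> lcosets K" if "c \<in> lcosets K" for n :: nat and c
    using that a by (auto simp: LCOSETS_def lcos_m_assoc K.subset)
  have "range f \<subseteq> lcosets K \<rightarrow>\<^sub>E lcosets K"
    using closed by (auto simp: f_def)
  then have "finite (range f)"
    by (rule finite_subset) (simp add: finite_PiE K(2))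
  then have "\<not> inj f"
    using finite_imageD[of f UNIV] by auto
  then obtain i j where ij: "i < j" "f i = f j"
    by (metis injI linorder_neqE_nat)
  have "inv d \<otimes> a [^] (j - i) \<otimes> d \<in> K" if d: "d \<in> carrier G" for d
  proof -
    have dK: "d <# K \<in> lcosets K"
      using d by (auto simp: LCOSETS_def)
    then have "(a [^] i) <# (d <# K) = (a [^] j) <# (d <# K)"
      using fun_cong[OF ij(2), of "d <# K"] by (simp add: f_def)
    then have eq: "(a [^] i \<otimes> d) <# K = (a [^] j \<otimes> d) <# K"
      using a d by (simp add: lcos_m_assoc K.subset)
    have "a [^] j \<otimes> d \<in> (a [^] j \<otimes> d) <# K"
      using a d K by (simp add: lcos_self)
    then have "a [^] j \<otimes> d \<in> (a [^] i \<otimes> d) <# K"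
      using eq by simp
    then have "inv (a [^] i \<otimes> d) \<otimes> (a [^] j \<otimes> d) \<in> K"
      using K.lcos_module_imp[OF is_group] a d by simp
    moreover have "a [^] j = a [^] i \<otimes> a [^] (j - i)"
      using ij(1) a by (simp add: nat_pow_mult)
    ultimately show ?thesis
      using a d by (simp add: inv_mult_group m_assoc inv_cancel_left)
  qed
  then have "a [^] (j - i) \<in> normal_core G K"
    using a by (simp add: mem_normal_core_iff[OF K(1)])
  then show thesis
    using that[of "j - i"] ij(1) by simp
qed

text \<open>The order divides some positive exponent. Positivity matters because
  \<open>multiplicity p 0 = 0\<close>, so exponents are monotone under divisibility only for nonzero
  multiples.\<close>

lemma (in group) element_order_mod_core_pos:
  assumes "group_chain G \<G>" "a \<in> carrier G"
  shows "element_order_mod_core G \<G> a l > 0"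
proof -
  have "subgroup (\<G> l) G" "finite (lcosets (\<G> l))"
    using assms by (auto simp: group_chain_def)
  then show ?thesis
    by (metis assms(2) element_order_mod_core_dvd_iff finite_index_pow_mem_normal_core
        dvd_0_left_iff gr0I)
qed

section \<open>Steinitz orders for cofinal families of cores\<close>

lemma group_chain_antimono: "group_chain G \<G> \<Longrightarrow> i \<le> j \<Longrightarrow> \<G> j \<subseteq> \<G> i"
  by (rule lift_Suc_antimono_le) (auto simp: group_chain_def)

lemma normal_core_mono:
  assumes "K \<subseteq> L"
  shows "normal_core G K \<subseteq> normal_core G L"
  using assms unfolding normal_core_def l_coset_def r_coset_def by blast

text \<open>A smaller core gives a larger order in the sense of divisibility, so each term of the
  first supremum is dominated by a term of the second.\<close>

lemma (in group) steinitz_order_le: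
  assumes chain: "group_chain G \<G>" "group_chain G \<G>'" and a: "a \<in> carrier G"
    and cofinal: "\<And>l. \<exists>m. normal_core G (\<G>' m) \<subseteq> normal_core G (\<G> l)"
  shows "steinitz_order G \<G> a p \<le> steinitz_order G \<G>' a p"
proof -
  have sub: "subgroup (\<G> l) G" "subgroup (\<G>' l) G" for l
    using chain by (auto simp: group_chain_def)
  have "\<exists>m>0. steinitz_of_nat (element_order_mod_core G \<G> a l) p
      \<le> steinitz_of_nat (element_order_mod_core G \<G>' a m) p" for l
  proof -
    obtain m where m: "normal_core G (\<G>' m) \<subseteq> normal_core G (\<G> l)"
      using cofinal by blast
    \<comment> \<open>The least common multiple runs over positive indices only, while
      \<open>m\<close> may be 0; the successor is safe because the chain descends.\<close>
    have "normal_core G (\<G>' (Suc m)) \<subseteq> normal_core G (\<G> l)"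
      using m normal_core_mono[OF group_chain_antimono[OF chain(2), of m "Suc m"]] by auto
    \<comment> \<open>Raised to its order at \<open>Suc m\<close>, \<open>a\<close> lies in the
      smaller core, hence in the larger one.\<close>
    then have "element_order_mod_core G \<G> a l dvd element_order_mod_core G \<G>' a (Suc m)"
      using element_order_mod_core_dvd_iff[of \<G>' "Suc m", OF sub(2) a, of "element_order_mod_core G \<G>' a (Suc m)"]
      by (subst element_order_mod_core_dvd_iff[of \<G> l, OF sub(1) a]) auto
    then have "steinitz_of_nat (element_order_mod_core G \<G> a l) p
        \<le> steinitz_of_nat (element_order_mod_core G \<G>' a (Suc m)) p"
      using element_order_mod_core_pos[OF chain(2) a, of "Suc m"]
      by (auto simp: steinitz_of_nat_def intro!: dvd_imp_multiplicity_le)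
    then show ?thesis
      by blast
  qed
  then show ?thesis
    unfolding steinitz_order_def steinitz_lcm_def by (intro SUP_mono) blast
qed

lemma (in group) typeset_eqI:
  assumes "group_chain G \<G>" "group_chain G \<G>'"
    and "\<And>l. \<exists>m. normal_core G (\<G>' m) \<subseteq> normal_core G (\<G> l)"
    and "\<And>l. \<exists>m. normal_core G (\<G> m) \<subseteq> normal_core G (\<G>' l)"
  shows "typeset G \<G> = typeset G \<G>'"
proof -
  have "steinitz_order G \<G> a = steinitz_order G \<G>' a" if "a \<in> carrier G" for a
    using steinitz_order_le[OF assms(1,2) that assms(3)] steinitz_order_le[OF assms(2,1) that assms(4)]
    by (intro ext antisym) auto
  then show ?thesis
    unfolding typeset_def by (intro Collect_cong) metis
qed

section \<open>Independence of the group chain model\<close>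

lemma chain_limit_setE:
  assumes "s \<in> chain_limit_set G \<G>"
  obtains g where "g \<in> carrier G" "s l = g <#\<^bsub>G\<^esub> \<G> l"
  using assms unfolding chain_limit_set_def by blast

lemma chain_limit_set_component:
  "s \<in> chain_limit_set G \<G> \<Longrightarrow> s l \<in> lcosets\<^bsub>G\<^esub> (\<G> l)"
  by (erule chain_limit_setE[where l = l]) (auto simp: LCOSETS_def)

lemma topspace_chain_limit:
  "topspace (chain_limit G \<G>) = chain_limit_set G \<G>"
  by (auto simp: chain_limit_def intro: chain_limit_set_component)

text \<open>The chain \<open>\<G>\<close> itself, read as the sequence of identity cosets, serves as
  base point. A basic open set of the product constrains finitely many coordinates, and
  \<open>m\<close> bounds their indices.\<close>

lemma (in group) chain_limit_neighbourhood:
  assumes chain: "group_chain G \<G>" and W: "openin (chain_limit G \<G>) W" "\<G> \<in> W"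
  obtains m where "\<And>s. s \<in> chain_limit_set G \<G> \<Longrightarrow> (\<And>i. i \<le> m \<Longrightarrow> s i = \<G> i) \<Longrightarrow> s \<in> W"
proof -
  let ?P = "product_topology (\<lambda>l. discrete_topology (lcosets (\<G> l))) UNIV"
  obtain T where T: "openin ?P T" "W = T \<inter> chain_limit_set G \<G>"
    using W(1) by (auto simp: chain_limit_def openin_subtopology)
  then obtain U where U: "finite {i. U i \<noteq> lcosets (\<G> i)}" "\<G> \<in> Pi\<^sub>E UNIV U" "Pi\<^sub>E UNIV U \<subseteq> T"
    using W(2) unfolding openin_product_topology_alt by auto
  obtain m where m: "\<And>i. U i \<noteq> lcosets (\<G> i) \<Longrightarrow> i \<le> m"
    using U(1) unfolding finite_nat_set_iff_bounded_le by blast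
  have "s \<in> W" if s: "s \<in> chain_limit_set G \<G>" "\<And>i. i \<le> m \<Longrightarrow> s i = \<G> i" for s
  proof -
    have "s i \<in> U i" for i
    proof (cases "i \<le> m")
      case True
      then show ?thesis
        using s(2) U(2) by (simp add: PiE_iff)
    next
      case False
      then have "U i = lcosets (\<G> i)"
        using m by blast
      then show ?thesis
        using chain_limit_set_component[OF s(1)] by simp
    qed
    then show ?thesis
      using U(3) T(2) s(1) by (auto simp: PiE_iff)
  qed
  then show thesis
    using that by blast
qed

lemma (in group) chain_action_base_point:
  assumes "group_chain G \<G>" "g \<in> carrier G"
  shows "chain_action G g \<G> \<in> chain_limit_set G \<G>"
  using assms by (auto simp: chain_action_def chain_limit_set_def)

text \<open>An equivariant continuous map \<open>k\<close> between the limits sends the base point \<open>\<G>\<close> to some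
  sequence of cosets \<open>g\<^sub>l \<G>' l\<close>. By continuity its \<open>l\<close>-th term is fixed by \<open>\<G> m\<close> for large \<open>m\<close>,
  so \<open>\<G> m\<close> is contained in the conjugate of \<open>\<G>' l\<close> by \<open>g\<^sub>l\<close>.\<close>

lemma (in group) normal_core_cofinal:
  assumes chain: "group_chain G \<G>" "group_chain G \<G>'"
    and cont: "continuous_map (chain_limit G \<G>) (chain_limit G \<G>') k"
    and equiv: "\<And>g s. g \<in> carrier G \<Longrightarrow> s \<in> chain_limit_set G \<G> \<Longrightarrow>
      k (chain_action G g s) = chain_action G g (k s)"
  shows "\<exists>m. normal_core G (\<G> m) \<subseteq> normal_core G (\<G>' l)"
proof -
  have sub: "subgroup (\<G> i) G" "subgroup (\<G>' i) G" for i
    using chain by (auto simp: group_chain_def)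
  interpret K: subgroup "\<G>' l" G by (rule sub)
  have base: "\<G> \<in> chain_limit_set G \<G>"
    using chain_action_base_point[OF chain(1) one_closed] sub
    by (simp add: chain_action_def lcos_mult_one subgroup.subset)
  then have "k \<G> \<in> chain_limit_set G \<G>'"
    using cont by (auto simp: continuous_map_def topspace_chain_limit)
  then obtain g where g: "g \<in> carrier G" "k \<G> l = g <# \<G>' l"
    by (rule chain_limit_setE)
  let ?W = "{s \<in> topspace (chain_limit G \<G>). k s l \<in> {k \<G> l}}"
  have "continuous_map (chain_limit G \<G>') (discrete_topology (lcosets (\<G>' l))) (\<lambda>s. s l)"
    unfolding chain_limit_def
    by (intro continuous_map_from_subtopology continuous_map_product_projection) auto
  from continuous_map_compose[OF cont this]
  have "continuous_map (chain_limit G \<G>) (discrete_topology (lcosets (\<G>' l))) (\<lambda>s. k s l)"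
    by (simp add: o_def)
  moreover have "openin (discrete_topology (lcosets (\<G>' l))) {k \<G> l}"
    using g by (auto simp: LCOSETS_def)
  ultimately have "openin (chain_limit G \<G>) ?W"
    by (rule openin_continuous_map_preimage)
  moreover have "\<G> \<in> ?W"
    using base by (simp add: topspace_chain_limit)
  ultimately obtain m where m: "\<And>s. s \<in> chain_limit_set G \<G> \<Longrightarrow> (\<And>i. i \<le> m \<Longrightarrow> s i = \<G> i) \<Longrightarrow> s \<in> ?W"
    using chain_limit_neighbourhood[OF chain(1)] by blast
  have incl: "inv g \<otimes> x \<otimes> g \<in> \<G>' l" if x: "x \<in> \<G> m" for x
  proof -
    have xG: "x \<in> carrier G"
      using x sub(1) subgroup.mem_carrier by metis
    \<comment> \<open>Since the chain descends, \<open>x\<close> lies in every earlier term and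
      fixes those cosets, so the translate of the base point stays in \<open>?W\<close>.\<close>
    have "chain_action G x \<G> i = \<G> i" if "i \<le> m" for i
      using group_chain_antimono[OF chain(1) that] x coset_join3[OF xG sub(1)]
      by (auto simp: chain_action_def)
    then have "chain_action G x \<G> \<in> ?W"
      using m chain_action_base_point[OF chain(1) xG] by blast
    then have "x <# (g <# \<G>' l) = g <# \<G>' l"
      using equiv[OF xG base] g by (simp add: chain_action_def)
    then have "(x \<otimes> g) <# \<G>' l = g <# \<G>' l"
      using xG g(1) by (simp add: lcos_m_assoc K.subset)
    then have "x \<otimes> g \<in> g <# \<G>' l"
      using lcos_self[of "x \<otimes> g", OF _ sub(2)] xG g(1) by blast
    then show ?thesis
      using K.lcos_module_imp[OF is_group, of g "x \<otimes> g"] xG g(1) by (simp add: m_assoc)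
  qed
  have "x \<in> normal_core G (\<G>' l)" if "x \<in> normal_core G (\<G> m)" for x
  proof -
    have x: "x \<in> carrier G" "\<And>d. d \<in> carrier G \<Longrightarrow> inv d \<otimes> x \<otimes> d \<in> \<G> m"
      using that mem_normal_core_iff[OF sub(1)] by auto
    have "inv d \<otimes> x \<otimes> d \<in> \<G>' l" if d: "d \<in> carrier G" for d
    proof -
      \<comment> \<open>The representative \<open>g\<close> is absorbed into the conjugator: the
        core condition at \<open>d \<otimes> inv g\<close> followed by \<open>incl\<close> gives the
        condition at \<open>d\<close>.\<close>
      have "inv d \<otimes> x \<otimes> d = inv g \<otimes> (inv (d \<otimes> inv g) \<otimes> x \<otimes> (d \<otimes> inv g)) \<otimes> g"
        using d g(1) x(1) by (simp add: inv_mult_group m_assoc inv_cancel_left)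
      then show ?thesis
        using incl x(2)[of "d \<otimes> inv g"] d g(1) by simp
    qed
    then show ?thesis
      using x(1) mem_normal_core_iff[OF sub(2)] by blast
  qed
  then show ?thesis
    by blast
qed

text \<open>Composing the inverse of one model map with the other gives an equivariant continuous
  map between the limits. Exchanging the models yields the opposite cofinality.\<close>

lemma group_chain_models_cofinal:
  assumes act: "group_action G (topspace X) \<Phi>"
    and model: "group_chain_model X G \<Phi> \<G>" "group_chain_model X G \<Phi> \<G>'"
  shows "\<exists>m. normal_core G (\<G> m) \<subseteq> normal_core G (\<G>' l)"
proof -
  interpret act: group_action G "topspace X" \<Phi> by fact
  interpret group G using act.group_hom by (simp add: group_hom_def)
  obtain h where h: "homeomorphic_map X (chain_limit G \<G>) h"
    and equiv: "\<And>g x. g \<in> carrier G \<Longrightarrow> x \<in> topspace X \<Longrightarrow> h (\<Phi> g x) = chain_action G g (h x)"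
    using model(1) by (auto simp: group_chain_model_def)
  obtain h' where h': "homeomorphic_map X (chain_limit G \<G>') h'"
    and equiv': "\<And>g x. g \<in> carrier G \<Longrightarrow> x \<in> topspace X \<Longrightarrow> h' (\<Phi> g x) = chain_action G g (h' x)"
    using model(2) by (auto simp: group_chain_model_def)
  obtain f where f: "homeomorphic_maps X (chain_limit G \<G>) h f"
    using h homeomorphic_map_maps by blast
  show ?thesis
  proof (rule normal_core_cofinal)
    show "group_chain G \<G>" "group_chain G \<G>'"
      using model by (auto simp: group_chain_model_def)
    show "continuous_map (chain_limit G \<G>) (chain_limit G \<G>') (h' \<circ> f)"
      using f h' by (auto simp: homeomorphic_maps_def intro: continuous_map_compose homeomorphic_imp_continuous_map)
    show "(h' \<circ> f) (chain_action G g s) = chain_action G g ((h' \<circ> f) s)"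
      if g: "g \<in> carrier G" and s: "s \<in> chain_limit_set G \<G>" for g s
    proof -
      have fs: "f s \<in> topspace X" "h (f s) = s"
        using f s by (auto simp: homeomorphic_maps_def continuous_map_def topspace_chain_limit)
      \<comment> \<open>The inverse \<open>f\<close> cancels \<open>h\<close> only on points of the
        space; this is what makes \<open>f\<close> equivariant.\<close>
      have "\<Phi> g (f s) \<in> topspace X"
        using act.element_image g fs(1) by blast
      then have "f (chain_action G g s) = \<Phi> g (f s)"
        using equiv[OF g fs(1)] fs f by (metis homeomorphic_maps_def)
      then show ?thesis
        using equiv'[OF g fs(1)] by simp
    qed
  qed
qed

lemma group_chain_models_typeset_eq:
  assumes act: "group_action G (topspace X) \<Phi>"
    and model: "group_chain_model X G \<Phi> \<G>" "group_chain_model X G \<Phi> \<G>'"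
  shows "typeset G \<G> = typeset G \<G>'"
proof -
  interpret act: group_action G "topspace X" \<Phi> by fact
  interpret group G using act.group_hom by (simp add: group_hom_def)
  show ?thesis
    using model group_chain_models_cofinal[OF act model] group_chain_models_cofinal[OF act model(2,1)]
    by (intro typeset_eqI) (auto simp: group_chain_model_def)
qed

section \<open>Transport along isomorphisms\<close>

lemma (in group_hom) image_l_coset:
  assumes "x \<in> carrier G" "K \<subseteq> carrier G"
  shows "h ` (x <# K) = h x <#\<^bsub>H\<^esub> h ` K"
  using assms by (force simp: l_coset_def)

lemma (in group_hom) image_chain_limit_set:
  assumes "group_chain G \<G>" "s \<in> chain_limit_set G \<G>"
  shows "(\<lambda>l. h ` s l) \<in> chain_limit_set H (\<lambda>l. h ` \<G> l)"
proof -
  have "\<G> l \<subseteq> carrier G" for l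
    using assms(1) by (simp add: group_chain_def subgroup.subset)
  then have "h ` (g <# \<G> l) = h g <#\<^bsub>H\<^esub> h ` \<G> l" if "g \<in> carrier G" for g l
    using that by (simp add: image_l_coset)
  then show ?thesis
    using assms(2) hom_closed unfolding chain_limit_set_def mem_Collect_eq by metis
qed

lemma (in group_hom) image_lcosets:
  assumes "K \<subseteq> carrier G" "c \<in> lcosets K"
  shows "h ` c \<in> lcosets\<^bsub>H\<^esub> (h ` K)"
proof -
  obtain x where "x \<in> carrier G" "c = x <# K"
    using assms(2) by (auto simp: LCOSETS_def)
  then show ?thesis
    using image_l_coset[OF _ assms(1)] by (auto simp: LCOSETS_def)
qed

text \<open>Each coordinate of the image depends on a single coordinate of \<open>s\<close>, through
  a map of discrete spaces. The setting of homomorphisms lets the lemma serve both an isomorphism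
  and its inverse.\<close>

lemma (in group_hom) continuous_map_image_chain_limit:
  assumes "group_chain G \<G>"
  shows "continuous_map (chain_limit G \<G>) (chain_limit H (\<lambda>l. h ` \<G> l)) (\<lambda>s l. h ` s l)"
proof -
  have sub: "\<G> l \<subseteq> carrier G" for l
    using assms by (simp add: group_chain_def subgroup.subset)
  have "continuous_map (chain_limit G \<G>) (discrete_topology (lcosets\<^bsub>H\<^esub> (h ` \<G> l))) (\<lambda>s. h ` s l)" for l
  proof -
    have "continuous_map (chain_limit G \<G>) (discrete_topology (lcosets (\<G> l))) (\<lambda>s. s l)"
      unfolding chain_limit_def
      by (intro continuous_map_from_subtopology continuous_map_product_projection) auto
    moreover have "continuous_map (discrete_topology (lcosets (\<G> l)))
        (discrete_topology (lcosets\<^bsub>H\<^esub> (h ` \<G> l))) (\<lambda>c. h ` c)"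
      using image_lcosets[OF sub] by auto
    ultimately show ?thesis
      using continuous_map_compose[of "chain_limit G \<G>" _ "\<lambda>s. s l" _ "\<lambda>c. h ` c"] by (simp add: o_def)
  qed
  then show ?thesis
    using image_chain_limit_set[OF assms] topspace_chain_limit[of G \<G>]
    by (subst (2) chain_limit_def)
      (auto simp: continuous_map_in_subtopology continuous_map_componentwise_UNIV)
qed

section \<open>Chains, limits and cores under a group isomorphism\<close>

locale group_iso = group_hom +
  assumes iso: "h \<in> iso G H"
begin

lemma inj: "inj_on h (carrier G)" and surj: "h ` carrier G = carrier H"
  using iso by (auto simp: iso_def bij_betw_def)

abbreviation h_inv where "h_inv \<equiv> inv_into (carrier G) h"

text \<open>By surjectivity every coset of an image subgroup is the image of a coset, so finite
  index is preserved.\<close>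

lemma group_chain_image:
  assumes "group_chain G \<G>"
  shows "group_chain H (\<lambda>l. h ` \<G> l)"
proof -
  have "finite (lcosets\<^bsub>H\<^esub> (h ` \<G> l))" for l
  proof (rule finite_surj)
    show "finite (lcosets (\<G> l))"
      using assms by (simp add: group_chain_def)
    have "\<G> l \<subseteq> carrier G"
      using assms by (simp add: group_chain_def subgroup.subset)
    then show "lcosets\<^bsub>H\<^esub> (h ` \<G> l) \<subseteq> (\<lambda>c. h ` c) ` (lcosets (\<G> l))"
      by (auto simp: LCOSETS_def surj[symmetric] image_l_coset[symmetric])
  qed
  then show ?thesis
    using assms by (simp add: group_chain_def surj subgroup_img_is_subgroup image_mono)
qed

lemma homeomorphic_map_chain_limit:
  assumes chain: "group_chain G \<G>"
  shows "homeomorphic_map (chain_limit G \<G>) (chain_limit H (\<lambda>l. h ` \<G> l)) (\<lambda>s l. h ` s l)"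
proof -
  interpret inv: group_hom H G h_inv
    using G.iso_set_sym[OF iso] by (auto simp: group_hom_def group_hom_axioms_def iso_imp_homomorphism)
  have sub: "\<G> l \<subseteq> carrier G" for l
    using chain by (simp add: group_chain_def subgroup.subset)
  have chainH: "group_chain H (\<lambda>l. h ` \<G> l)"
    by (rule group_chain_image[OF chain])
  have cont_inv: "continuous_map (chain_limit H (\<lambda>l. h ` \<G> l)) (chain_limit G \<G>) (\<lambda>s l. h_inv ` s l)"
    using inv.continuous_map_image_chain_limit[OF chainH] by (simp add: inv_into_image_cancel[OF inj sub])
  \<comment> \<open>Terms of points of the limit are cosets, hence subsets of the carrier, where
    taking images under \<open>h\<close> and \<open>h_inv\<close> cancels.\<close>
  have left: "h_inv ` h ` s l = s l" if s: "s \<in> chain_limit_set G \<G>" for s l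
  proof -
    obtain g where "g \<in> carrier G" "s l = g <# \<G> l"
      using s by (rule chain_limit_setE)
    then show ?thesis
      using inv_into_image_cancel[OF inj] G.l_coset_subset_G[OF sub] by simp
  qed
  have right: "h ` h_inv ` s l = s l" if s: "s \<in> chain_limit_set H (\<lambda>l. h ` \<G> l)" for s l
  proof -
    obtain g where g: "g \<in> carrier H" "s l = g <#\<^bsub>H\<^esub> h ` \<G> l"
      using s by (rule chain_limit_setE)
    have "h ` \<G> l \<subseteq> carrier H"
      using sub surj by blast
    then have "s l \<subseteq> h ` carrier G"
      using H.l_coset_subset_G g surj by simp
    then show ?thesis
      by (rule image_inv_into_cancel[OF refl])
  qed
  have "homeomorphic_maps (chain_limit G \<G>) (chain_limit H (\<lambda>l. h ` \<G> l))
      (\<lambda>s l. h ` s l) (\<lambda>s l. h_inv ` s l)"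
    unfolding homeomorphic_maps_def
    using continuous_map_image_chain_limit[OF chain] cont_inv left right
    by (simp add: topspace_chain_limit)
  then show ?thesis
    by (rule homeomorphic_maps_imp_map)
qed

text \<open>Conjugation commutes with \<open>h\<close>; injectivity reflects membership in the image
  of \<open>K\<close>, and surjectivity lets the conjugators exhaust \<open>H\<close>.\<close>

lemma normal_core_image:
  assumes K: "subgroup K G" and x: "x \<in> carrier G"
  shows "h x \<in> normal_core H (h ` K) \<longleftrightarrow> x \<in> normal_core G K"
proof -
  have mem: "h y \<in> h ` K \<longleftrightarrow> y \<in> K" if "y \<in> carrier G" for y
    using that inj subgroup.subset[OF K] by (meson inj_on_image_mem_iff)
  have "inv\<^bsub>H\<^esub> h d \<otimes>\<^bsub>H\<^esub> h x \<otimes>\<^bsub>H\<^esub> h d \<in> h ` K \<longleftrightarrow> inv d \<otimes> x \<otimes> d \<in> K"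
    if "d \<in> carrier G" for d
    using mem[of "inv d \<otimes> x \<otimes> d"] that x by simp
  then show ?thesis
    using x by (simp add: H.mem_normal_core_iff G.mem_normal_core_iff K
        subgroup_img_is_subgroup[OF K] flip: surj)
qed

text \<open>The orders of \<open>a\<close> and \<open>h a\<close> divide the same numbers, so they
  are equal at every level. By surjectivity every element of \<open>H\<close> has the form
  \<open>h a\<close>.\<close>

lemma typeset_image:
  assumes chain: "group_chain G \<G>"
  shows "typeset H (\<lambda>l. h ` \<G> l) = typeset G \<G>"
proof -
  have sub: "subgroup (\<G> l) G" for l
    using chain by (simp add: group_chain_def)
  have "element_order_mod_core H (\<lambda>l. h ` \<G> l) (h a) l = element_order_mod_core G \<G> a l"
    if a: "a \<in> carrier G" for a l
  proof -
    have "element_order_mod_core H (\<lambda>l. h ` \<G> l) (h a) l dvd k \<longleftrightarrow> element_order_mod_core G \<G> a l dvd k" for k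
      using H.element_order_mod_core_dvd_iff[of "\<lambda>l. h ` \<G> l" l "h a" k]
        G.element_order_mod_core_dvd_iff[of \<G> l a k]
        normal_core_image[OF sub, of "a [^] k" l] hom_nat_pow[OF a, of k] a sub
      by (simp only: subgroup_img_is_subgroup hom_closed G.nat_pow_closed)
    then show ?thesis
      by (meson dvd_antisym dvd_refl)
  qed
  then have "steinitz_order H (\<lambda>l. h ` \<G> l) (h a) = steinitz_order G \<G> a" if "a \<in> carrier G" for a
    using that by (simp add: steinitz_order_def)
  then have "(\<lambda>a. steinitz_type (steinitz_order H (\<lambda>l. h ` \<G> l) (h a))) ` carrier G =
      (\<lambda>a. steinitz_type (steinitz_order G \<G> a)) ` carrier G"
    by (intro image_cong) auto
  then show ?thesis
    unfolding typeset_def Setcompr_eq_image Collect_mem_eq surj[symmetric] image_image .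
qed

end

text \<open>The image chain is the model, via the homeomorphism from \<open>Y\<close> back to
  \<open>X\<close>, on to the limit of \<open>\<G>\<close>, and then to the limit of the image
  chain. It is equivariant since \<open>\<Theta>\<close> carries translation by \<open>g\<close> to
  translation by \<open>\<Theta> g\<close>.\<close>

lemma isomorphic_actions_group_chain_model:
  assumes act: "group_action G (topspace X) \<Phi>" "group_action H (topspace Y) \<Psi>"
    and iso: "isomorphic_actions X G \<Phi> Y H \<Psi>"
    and model: "group_chain_model X G \<Phi> \<G>"
  shows "\<exists>\<H>. group_chain_model Y H \<Psi> \<H> \<and> typeset H \<H> = typeset G \<G>"
proof -
  interpret X: group_action G "topspace X" \<Phi> by (rule act)
  interpret Y: group_action H "topspace Y" \<Psi> by (rule act)
  obtain f f' \<Theta> where f: "homeomorphic_maps X Y f f'" and \<Theta>: "\<Theta> \<in> iso G H"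
    and ff: "\<And>g x. g \<in> carrier G \<Longrightarrow> x \<in> topspace X \<Longrightarrow> \<Phi> g x = f' (\<Psi> (\<Theta> g) (f x))"
    using iso by (auto simp: isomorphic_actions_def)
  interpret \<Theta>: group_iso G H \<Theta>
    using X.group_hom Y.group_hom \<Theta>
    by (auto simp: group_hom_def group_hom_axioms_def group_iso_def group_iso_axioms_def iso_imp_homomorphism)
  obtain h where chain: "group_chain G \<G>" and h: "homeomorphic_map X (chain_limit G \<G>) h"
    and equiv: "\<And>g x. g \<in> carrier G \<Longrightarrow> x \<in> topspace X \<Longrightarrow> h (\<Phi> g x) = chain_action G g (h x)"
    using model by (auto simp: group_chain_model_def)
  let ?\<H> = "\<lambda>l. \<Theta> ` \<G> l" and ?k = "(\<lambda>s l. \<Theta> ` s l) \<circ> (h \<circ> f')"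
  have sub: "\<G> l \<subseteq> carrier G" for l
    using chain by (simp add: group_chain_def subgroup.subset)
  have "homeomorphic_map Y (chain_limit H ?\<H>) ?k"
    using f h \<Theta>.homeomorphic_map_chain_limit[OF chain]
    by (meson homeomorphic_map_compose homeomorphic_maps_map)
  moreover have "?k (\<Psi> g' y) = chain_action H g' (?k y)" if g': "g' \<in> carrier H" and y: "y \<in> topspace Y" for g' y
  proof -
    obtain g where g: "g \<in> carrier G" "g' = \<Theta> g"
      using g' \<Theta>.surj by blast
    have f'y: "f' y \<in> topspace X" "f (f' y) = y"
      using f y by (auto simp: homeomorphic_maps_def continuous_map_def)
    then have lim: "h (f' y) \<in> chain_limit_set G \<G>"
      using homeomorphic_imp_surjective_map[OF h] topspace_chain_limit by auto
    \<comment> \<open>Moving the image past left translation by \<open>g\<close> requires the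
      translated set to lie in the carrier.\<close>
    have sl: "h (f' y) l \<subseteq> carrier G" for l
    proof -
      obtain c where "c \<in> carrier G" "h (f' y) l = c <#\<^bsub>G\<^esub> \<G> l"
        using lim by (rule chain_limit_setE)
      then show ?thesis
        using \<Theta>.G.l_coset_subset_G[OF sub] by simp
    qed
    have "h (f' (\<Psi> g' y)) = chain_action G g (h (f' y))"
      using equiv[OF g(1) f'y(1)] ff[OF g(1) f'y(1)] g(2) f'y(2) by simp
    then show ?thesis
      using \<Theta>.image_l_coset[OF g(1) sl] g(2) by (simp add: chain_action_def)
  qed
  ultimately have "group_chain_model Y H \<Psi> ?\<H>"
    using \<Theta>.group_chain_image[OF chain] unfolding group_chain_model_def by blast
  then show ?thesis
    using \<Theta>.typeset_image[OF chain] by blast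
qed

text \<open>Allows models to be carried from \<open>Y\<close> back to \<open>X\<close> as
  well.\<close>

lemma isomorphic_actions_sym:
  assumes act: "group_action G (topspace X) \<Phi>" "group_action H (topspace Y) \<Psi>"
    and iso: "isomorphic_actions X G \<Phi> Y H \<Psi>"
  shows "isomorphic_actions Y H \<Psi> X G \<Phi>"
proof -
  interpret X: group_action G "topspace X" \<Phi> by (rule act)
  interpret Y: group_action H "topspace Y" \<Psi> by (rule act)
  interpret G: group G using X.group_hom by (simp add: group_hom_def)
  obtain f f' \<Theta> where f: "homeomorphic_maps X Y f f'" and \<Theta>: "\<Theta> \<in> iso G H"
    and ff: "\<And>g x. g \<in> carrier G \<Longrightarrow> x \<in> topspace X \<Longrightarrow> \<Phi> g x = f' (\<Psi> (\<Theta> g) (f x))"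
    using iso by (auto simp: isomorphic_actions_def)
  let ?\<Theta>' = "inv_into (carrier G) \<Theta>"
  have surj: "\<Theta> ` carrier G = carrier H"
    using \<Theta> by (auto simp: iso_def bij_betw_def)
  have "\<Psi> g y = f (\<Phi> (?\<Theta>' g) (f' y))" if g: "g \<in> carrier H" and y: "y \<in> topspace Y" for g y
  proof -
    have "?\<Theta>' g \<in> carrier G" "\<Theta> (?\<Theta>' g) = g"
      using g surj by (auto intro: inv_into_into f_inv_into_f)
    moreover have "f' y \<in> topspace X" "f (f' y) = y"
      using f y by (auto simp: homeomorphic_maps_def continuous_map_def)
    ultimately have "\<Phi> (?\<Theta>' g) (f' y) = f' (\<Psi> g y)"
      using ff by simp
    moreover have "\<Psi> g y \<in> topspace Y"
      using Y.element_image g y by blast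
    ultimately show ?thesis
      using f by (simp add: homeomorphic_maps_def)
  qed
  then show ?thesis
    unfolding isomorphic_actions_def
    using f homeomorphic_maps_sym G.iso_set_sym[OF \<Theta>] by blast
qed

theorem theorem1p7:
  fixes X :: "'a topology" and G :: "('g, 'm) monoid_scheme" and \<Phi> :: "'g \<Rightarrow> 'a \<Rightarrow> 'a"
    and Y :: "'b topology" and H :: "('h, 'n) monoid_scheme" and \<Psi> :: "'h \<Rightarrow> 'b \<Rightarrow> 'b"
  assumes "odometer X G \<Phi>"
  shows "(\<forall>\<G> \<G>'. group_chain_model X G \<Phi> \<G> \<longrightarrow> group_chain_model X G \<Phi> \<G>' \<longrightarrow>
            typeset G \<G> = typeset G \<G>') \<and>
         (\<forall>\<G>. group_chain_model X G \<Phi> \<G> \<longrightarrow> odometer_typeset X G \<Phi> = typeset G \<G>) \<and>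
         (odometer Y H \<Psi> \<longrightarrow> isomorphic_actions X G \<Phi> Y H \<Psi> \<longrightarrow>
            odometer_typeset X G \<Phi> = odometer_typeset Y H \<Psi> \<and>
            (\<forall>\<G> \<H>. group_chain_model X G \<Phi> \<G> \<longrightarrow> group_chain_model Y H \<Psi> \<H> \<longrightarrow>
               typeset G \<G> = typeset H \<H>))"
proof (intro conjI impI allI)
  have actX: "group_action G (topspace X) \<Phi>"
    using assms by (simp add: odometer_def cantor_action_def)
  show indep: "typeset G \<G> = typeset G \<G>'"
    if "group_chain_model X G \<Phi> \<G>" "group_chain_model X G \<Phi> \<G>'" for \<G> \<G>'
    by (rule group_chain_models_typeset_eq[OF actX that])
  show "odometer_typeset X G \<Phi> = typeset G \<G>" if "group_chain_model X G \<Phi> \<G>" for \<G>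
    unfolding odometer_typeset_def using that indep by (intro the_equality) blast+
  assume "odometer Y H \<Psi>" and iso: "isomorphic_actions X G \<Phi> Y H \<Psi>"
  then have actY: "group_action H (topspace Y) \<Psi>"
    by (simp add: odometer_def cantor_action_def)
  note transport = isomorphic_actions_group_chain_model[OF actX actY iso]
    isomorphic_actions_group_chain_model[OF actY actX isomorphic_actions_sym[OF actX actY iso]]
  \<comment> \<open>The two invariants are descriptions over the same predicate on \<open>T\<close>,
    hence equal whether or not the description denotes.\<close>
  have "(\<exists>\<G>. group_chain_model X G \<Phi> \<G> \<and> T = typeset G \<G>) \<longleftrightarrow>
      (\<exists>\<H>. group_chain_model Y H \<Psi> \<H> \<and> T = typeset H \<H>)" for T
    using transport by metis
  then show "odometer_typeset X G \<Phi> = odometer_typeset Y H \<Psi>"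
    unfolding odometer_typeset_def by simp
  \<comment> \<open>The chain transported from \<open>\<G>\<close> may differ from
    \<open>\<H>\<close>, but both model the action on \<open>Y\<close>.\<close>
  show "typeset G \<G> = typeset H \<H>"
    if "group_chain_model X G \<Phi> \<G>" "group_chain_model Y H \<Psi> \<H>" for \<G> \<H>
    using transport(1)[OF that(1)] group_chain_models_typeset_eq[OF actY _ that(2)] by metis
qed

end
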